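(* With respect to Knuth-equivalence, every classical pattern $p\in\mathfrak S_3$ is stable; that is, for every $p\in\mathfrak S_3$ and every $n$, $\widetilde{\mathfrak A}_n(p)=\mathfrak A_n(\widetilde p)$.
   Context: An elementary Knuth-transformation on a permutation (in one-line notation) applies to three consecutive letters one of the replacements $yzx\mapsto yxz$ if $x<y\le z$, or $xzy\mapsto zxy$ if $x\le y<z$, or one of their inverses. Two permutations are Knuth-equivalent if one can be obtained from the other by a sequence of elementary Knuth-transformations; equivalently, they have the same insertion tableau under Robinson–Schensted row insertion. Classical patterns are permutations $p$; two classical patterns are equivalent if they are Knuth-equivalent as permutations, and $\widetilde p$ denotes the equivalence class of $p$. A permutation avoids a classical pattern $p$ if it has no subsequence (of not necessarily adjacent letters) in the same relative order as $p$. $\widetilde{\mathfrak A}_n(p)$ is the set of $\pi\in\mathfrak S_n$ such that $\pi$ and every permutation equivalent to $\pi$ avoids $p$. $\mathfrak A_n(\widetilde p)$ is the set of $\pi\in\mathfrak S_n$ that avoid $p$ and every pattern equivalent to $p$. A pattern $p$ is stable if $\widetilde{\mathfrak A}_n(p)=\mathfrak A_n(\widetilde p)$ for all $n$. *)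

theory Defs
  imports "HOL-Library.Sublist" "HOL-Combinatorics.Multiset_Permutations"
begin

(* Permutations are in one-line notation, as lists of the letters 1, ..., n. *)
abbreviation Sym :: "nat \<Rightarrow> nat list set" where
  "Sym n \<equiv> permutations_of_set {1..n}"

inductive knuth_step :: "nat list \<Rightarrow> nat list \<Rightarrow> bool" where
  yzx: "x < y \<Longrightarrow> y \<le> z \<Longrightarrow> knuth_step (us @ [y, z, x] @ vs) (us @ [y, x, z] @ vs)"
| xzy: "x \<le> y \<Longrightarrow> y < z \<Longrightarrow> knuth_step (us @ [x, z, y] @ vs) (us @ [z, x, y] @ vs)"

(* equivclp r is the reflexive-transitive closure of r together with its inverse: finite
   sequences of the two replacements and their inverses. *)
definition knuth_equiv :: "nat list \<Rightarrow> nat list \<Rightarrow> bool" where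
  "knuth_equiv = equivclp knuth_step"

definition same_relative_order :: "nat list \<Rightarrow> nat list \<Rightarrow> bool" where
  "same_relative_order xs ys \<longleftrightarrow>
     length xs = length ys \<and>
     (\<forall>i < length xs. \<forall>j < length xs. xs ! i < xs ! j \<longleftrightarrow> ys ! i < ys ! j)"

definition avoids :: "nat list \<Rightarrow> nat list \<Rightarrow> bool" where
  "avoids \<pi> p \<longleftrightarrow> \<not> (\<exists>\<sigma>. subseq \<sigma> \<pi> \<and> same_relative_order \<sigma> p)"

definition pattern_class :: "nat list \<Rightarrow> nat list set" where
  "pattern_class p = {q \<in> Sym (length p). knuth_equiv p q}"

definition class_avoiders :: "nat \<Rightarrow> nat list \<Rightarrow> nat list set" where
  "class_avoiders n p =
     {\<pi> \<in> Sym n. \<forall>\<sigma> \<in> Sym n. knuth_equiv \<pi> \<sigma> \<longrightarrow> avoids \<sigma> p}"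

definition avoiders :: "nat \<Rightarrow> nat list set \<Rightarrow> nat list set" where
  "avoiders n P = {\<pi> \<in> Sym n. \<forall>q \<in> P. avoids \<pi> q}"

definition stable_pattern :: "nat list \<Rightarrow> bool" where
  "stable_pattern p \<longleftrightarrow> (\<forall>n. class_avoiders n p = avoiders n (pattern_class p))"

end

theory Submission
  imports Defs
begin

text \<open>
  The Knuth classes of patterns of length 3 are \<open>{123}\<close>, \<open>{321}\<close>, \<open>{213, 231}\<close> and
  \<open>{132, 312}\<close>. Reversing words preserves Knuth equivalence of words with distinct letters, so
  only \<open>123\<close>, \<open>213\<close> and \<open>231\<close> need attention. That a Knuth step preserves the
  existence of an increasing triple, and of a letter with both a smaller and a larger letter
  after it (a pivot), is checked by replacing swapped letters by the witness of the swap. Finally,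
  a word with a pivot is equivalent to one in which three consecutive letters
  form \<open>213\<close>, hence also to one in which they form \<open>231\<close>: one looks at the two letters
  directly after the pivot. If neither arrangement is already there, then either the pivot moves
  one place to the right by a Knuth step, or the next letter is itself a pivot.
\<close>

section \<open>Basic properties of Knuth equivalence\<close>

lemma knuth_equiv_refl [simp]: "knuth_equiv \<pi> \<pi>"
  by (simp add: knuth_equiv_def)

lemma knuth_equiv_sym: "knuth_equiv \<pi> \<sigma> \<Longrightarrow> knuth_equiv \<sigma> \<pi>"
  by (simp add: knuth_equiv_def equivclp_sym)

lemma knuth_equiv_trans [trans]:
  "knuth_equiv \<pi> \<sigma> \<Longrightarrow> knuth_equiv \<sigma> \<tau> \<Longrightarrow> knuth_equiv \<pi> \<tau>"
  unfolding knuth_equiv_def by (rule equivclp_trans)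

lemma knuth_step_imp_equiv: "knuth_step \<pi> \<sigma> \<Longrightarrow> knuth_equiv \<pi> \<sigma>"
  unfolding knuth_equiv_def by (rule r_into_equivclp)

lemma knuth_step_mset: "knuth_step \<pi> \<sigma> \<Longrightarrow> mset \<sigma> = mset \<pi>"
  by (induction rule: knuth_step.induct) auto

lemma knuth_step_distinct: "knuth_step \<pi> \<sigma> \<Longrightarrow> distinct \<sigma> \<longleftrightarrow> distinct \<pi>"
  using knuth_step_mset mset_eq_imp_distinct_iff by blast

text \<open>A chain of steps and inverse steps is followed link by link. The equivalence in
  \<open>step\<close> serves both directions of a link, and distinctness, which \<open>step\<close>
  may assume, is carried along because a step only rearranges letters.\<close>

lemma knuth_equiv_invariant:
  assumes step: "\<And>\<pi> \<sigma>. distinct \<pi> \<Longrightarrow> knuth_step \<pi> \<sigma> \<Longrightarrow> Q \<pi> \<longleftrightarrow> Q \<sigma>"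
    and "knuth_equiv \<pi> \<sigma>" "distinct \<pi>"
  shows "Q \<pi> \<longleftrightarrow> Q \<sigma>"
proof -
  have "distinct \<sigma> \<and> (Q \<pi> \<longleftrightarrow> Q \<sigma>)"
    using assms(2) unfolding knuth_equiv_def
  proof (induction rule: equivclp_induct)
    case base
    then show ?case using assms(3) by simp
  next
    case (step \<tau> \<rho>)
    then show ?case using assms(1) knuth_step_distinct by metis
  qed
  then show ?thesis by simp
qed

lemma knuth_equiv_mset:
  assumes "knuth_equiv \<pi> \<sigma>" "distinct \<pi>"
  shows "mset \<sigma> = mset \<pi>"
  using knuth_equiv_invariant[of "\<lambda>\<tau>. mset \<tau> = mset \<pi>", OF _ assms] knuth_step_mset by simp

lemma knuth_equiv_Sym:
  assumes "knuth_equiv \<pi> \<sigma>" "\<pi> \<in> Sym n"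
  shows "\<sigma> \<in> Sym n"
  using knuth_equiv_mset[OF assms(1)] assms(2)
  by (metis mset_eq_imp_distinct_iff mset_eq_setD permutations_of_set_def mem_Collect_eq)

section \<open>Symmetry under reversal of words\<close>

lemma knuth_step_rev:
  assumes "distinct \<pi>" "knuth_step \<pi> \<sigma>"
  shows "knuth_step (rev \<pi>) (rev \<sigma>)"
  using assms(2,1)
proof cases
  \<comment> \<open>Reversal exchanges the two rules; distinctness turns the weak inequality of one
    rule into the strict one of the other.\<close>
  case (yzx x y z us vs)
  then show ?thesis
    using assms(1) knuth_step.xzy[of x y z "rev vs" "rev us"] by simp
next
  case (xzy x y z us vs)
  then show ?thesis
    using assms(1) knuth_step.yzx[of x y z "rev vs" "rev us"] by simp
qed

lemma knuth_equiv_rev: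
  assumes "knuth_equiv \<pi> \<sigma>" "distinct \<pi>"
  shows "knuth_equiv (rev \<pi>) (rev \<sigma>)"
proof -
  \<comment> \<open>The invariant is equivalence of the reversed word to \<open>rev \<pi>\<close>;
    it holds at \<open>\<pi>\<close> by reflexivity and is then carried to
    \<open>\<sigma>\<close>.\<close>
  have "knuth_equiv (rev \<pi>) (rev \<tau>) \<longleftrightarrow> knuth_equiv (rev \<pi>) (rev \<rho>)"
    if "distinct \<tau>" "knuth_step \<tau> \<rho>" for \<tau> \<rho>
    using knuth_step_imp_equiv[OF knuth_step_rev[OF that]] knuth_equiv_sym knuth_equiv_trans
    by blast
  from knuth_equiv_invariant[of "\<lambda>\<tau>. knuth_equiv (rev \<pi>) (rev \<tau>)", OF this assms]
  show ?thesis by simp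
qed

lemma same_relative_order_rev:
  "same_relative_order xs ys \<Longrightarrow> same_relative_order (rev xs) (rev ys)"
  unfolding same_relative_order_def by (auto simp: rev_nth)

lemma subseq_rev: "subseq xs ys \<Longrightarrow> subseq (rev xs) (rev ys)"
  by (induction rule: list_emb.induct) (auto intro: list_emb_append_mono subseq_rev_drop_many)

lemma avoids_rev: "avoids (rev \<pi>) (rev p) \<longleftrightarrow> avoids \<pi> p"
proof -
  have "avoids (rev \<pi>) (rev p) \<Longrightarrow> avoids \<pi> p" for \<pi> p
    unfolding avoids_def using same_relative_order_rev by (metis subseq_rev)
  \<comment> \<open>Applied to the reversed words, the same implication is the converse, since
    \<open>rev\<close> is an involution.\<close>
  from this this[of "rev \<pi>" "rev p"] show ?thesis by auto
qed

lemma Sym_rev: "rev \<pi> \<in> Sym n \<longleftrightarrow> \<pi> \<in> Sym n"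
  by (simp add: permutations_of_set_def)

lemma Sym_distinct: "\<pi> \<in> Sym n \<Longrightarrow> distinct \<pi>"
  by (simp add: permutations_of_set_def)

lemma pattern_class_rev:
  assumes "distinct p"
  shows "q \<in> pattern_class (rev p) \<longleftrightarrow> rev q \<in> pattern_class p"
proof -
  have "knuth_equiv (rev p) q \<longleftrightarrow> knuth_equiv p (rev q)"
    using knuth_equiv_rev[of "rev p" q] knuth_equiv_rev[of p "rev q"] assms by auto
  then show ?thesis using Sym_rev[of q "length p"] by (auto simp: pattern_class_def)
qed

lemma class_avoiders_rev: "\<pi> \<in> class_avoiders n (rev p) \<longleftrightarrow> rev \<pi> \<in> class_avoiders n p"
proof -
  have "rev \<pi> \<in> class_avoiders n p" if *: "\<pi> \<in> class_avoiders n (rev p)" for \<pi> p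
  proof -
    have "avoids \<sigma> p" if "\<sigma> \<in> Sym n" "knuth_equiv (rev \<pi>) \<sigma>" for \<sigma>
    proof -
      have "knuth_equiv \<pi> (rev \<sigma>)"
        using knuth_equiv_rev[OF that(2)] * Sym_distinct[of \<pi> n] by (simp add: class_avoiders_def)
      then have "avoids (rev \<sigma>) (rev p)"
        using * that(1) Sym_rev[of \<sigma> n] by (simp add: class_avoiders_def)
      then show ?thesis by (simp add: avoids_rev)
    qed
    then show ?thesis using * Sym_rev[of \<pi> n] by (simp add: class_avoiders_def)
  qed
  from this this[of "rev \<pi>" "rev p"] show ?thesis by auto
qed

lemma avoiders_pattern_class_rev:
  assumes "distinct p"
  shows "\<pi> \<in> avoiders n (pattern_class (rev p)) \<longleftrightarrow> rev \<pi> \<in> avoiders n (pattern_class p)"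
  unfolding avoiders_def using pattern_class_rev[OF assms] Sym_rev avoids_rev
  by (smt (verit) mem_Collect_eq rev_rev_ident)

lemma stable_pattern_rev:
  assumes "stable_pattern p" "distinct p"
  shows "stable_pattern (rev p)"
  using assms class_avoiders_rev avoiders_pattern_class_rev
  unfolding stable_pattern_def by blast

section \<open>A criterion for stability\<close>

text \<open>Inside \<open>Sym n\<close> both sets are the complement of the invariant
  \<open>Q\<close>. A word satisfying \<open>Q\<close> is excluded from one set by
  \<open>reach\<close> and from the other by \<open>contains\<close>. Conversely, an occurrence of
  \<open>p\<close> in an equivalent word, or of a pattern from the class in the word itself, forces
  \<open>Q\<close> by \<open>pattern\<close> and invariance, since \<open>Q p\<close> spreads to the
  whole class.\<close>

lemma stable_patternI:
  assumes step: "\<And>\<pi> \<sigma>. distinct \<pi> \<Longrightarrow> knuth_step \<pi> \<sigma> \<Longrightarrow> Q \<pi> \<longleftrightarrow> Q \<sigma>"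
    and p: "Q p" "distinct p"
    and pattern: "\<And>\<pi> q. length q = length p \<Longrightarrow> Q q \<Longrightarrow> \<not> avoids \<pi> q \<Longrightarrow> Q \<pi>"
    and contains: "\<And>\<pi>. Q \<pi> \<Longrightarrow> \<exists>q \<in> pattern_class p. \<not> avoids \<pi> q"
    and reach: "\<And>\<pi>. distinct \<pi> \<Longrightarrow> Q \<pi> \<Longrightarrow> \<exists>\<sigma>. knuth_equiv \<pi> \<sigma> \<and> \<not> avoids \<sigma> p"
  shows "stable_pattern p"
proof -
  have inv: "Q \<pi> \<longleftrightarrow> Q \<sigma>" if "knuth_equiv \<pi> \<sigma>" "distinct \<pi>" for \<pi> \<sigma>
    using knuth_equiv_invariant[of Q, OF step that] by simp
  have pattern_class: "Q q \<and> length q = length p" if "q \<in> pattern_class p" for q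
    using that inv[of p q] p length_finite_permutations_of_set[of q "{1..length p}"]
    by (simp add: pattern_class_def)
  have "\<pi> \<in> class_avoiders n p \<longleftrightarrow> \<not> Q \<pi>" if "\<pi> \<in> Sym n" for \<pi> n
    unfolding class_avoiders_def using that knuth_equiv_Sym reach pattern[OF refl p(1)] inv
      Sym_distinct by blast
  moreover have "\<pi> \<in> avoiders n (pattern_class p) \<longleftrightarrow> \<not> Q \<pi>" if "\<pi> \<in> Sym n" for \<pi> n
    unfolding avoiders_def using that contains pattern pattern_class by blast
  ultimately show ?thesis
    unfolding stable_pattern_def class_avoiders_def avoiders_def by blast
qed

section \<open>Occurrences of patterns of length 3\<close>

lemma length_3_conv: "length xs = 3 \<longleftrightarrow> (\<exists>a b c. xs = [a, b, c])"
  by (auto simp: numeral_3_eq_3 length_Suc_conv)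

lemma same_relative_order_3:
  "same_relative_order [a, b, c] [p, q, r] \<longleftrightarrow>
     (a < b \<longleftrightarrow> p < q) \<and> (a < c \<longleftrightarrow> p < r) \<and> (b < c \<longleftrightarrow> q < r) \<and>
     (b < a \<longleftrightarrow> q < p) \<and> (c < a \<longleftrightarrow> r < p) \<and> (c < b \<longleftrightarrow> r < q)"
proof -
  have "(\<forall>i < Suc (Suc (Suc 0)). P i) \<longleftrightarrow> P 0 \<and> P 1 \<and> P 2" for P
    by (auto simp: less_Suc_eq numeral_2_eq_2)
  then show ?thesis
    by (auto simp: same_relative_order_def)
qed

lemma contains_3:
  "\<not> avoids \<pi> [p, q, r] \<longleftrightarrow>
     (\<exists>a b c. subseq [a, b, c] \<pi> \<and> same_relative_order [a, b, c] [p, q, r])"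
proof -
  have "same_relative_order \<sigma> [p, q, r] \<Longrightarrow> \<exists>a b c. \<sigma> = [a, b, c]" for \<sigma>
    by (simp add: same_relative_order_def flip: length_3_conv)
  then show ?thesis unfolding avoids_def by blast
qed

lemma contains_123:
  "\<not> avoids \<pi> [1, 2, 3] \<longleftrightarrow> (\<exists>x y z. x < y \<and> y < z \<and> subseq [x, y, z] \<pi>)"
proof -
  have "same_relative_order [x, y, z] [1, 2, 3] \<longleftrightarrow> x < y \<and> y < z" for x y z
    by (auto simp: same_relative_order_3)
  then show ?thesis by (simp only: contains_3) blast
qed

lemma contains_213:
  "\<not> avoids \<pi> [2, 1, 3] \<longleftrightarrow> (\<exists>x y z. x < y \<and> y < z \<and> subseq [y, x, z] \<pi>)"
proof -
  have "same_relative_order [y, x, z] [2, 1, 3] \<longleftrightarrow> x < y \<and> y < z" for x y z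
    by (auto simp: same_relative_order_3)
  then show ?thesis by (simp only: contains_3) blast
qed

lemma contains_231:
  "\<not> avoids \<pi> [2, 3, 1] \<longleftrightarrow> (\<exists>x y z. x < y \<and> y < z \<and> subseq [y, z, x] \<pi>)"
proof -
  have "same_relative_order [y, z, x] [2, 3, 1] \<longleftrightarrow> x < y \<and> y < z" for x y z
    by (auto simp: same_relative_order_3)
  then show ?thesis by (simp only: contains_3) blast
qed

section \<open>Increasing triples and pivots as invariants\<close>

lemma subseq_2_Cons:
  "subseq [a, b] (x # xs) \<longleftrightarrow> a = x \<and> b \<in> set xs \<or> subseq [a, b] xs"
  by (auto simp: subseq_singleton_left dest: subseq_Cons')

lemma subseq_3_Cons:
  "subseq [a, b, c] (x # xs) \<longleftrightarrow> a = x \<and> subseq [b, c] xs \<or> subseq [a, b, c] xs"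
  by (auto dest: subseq_Cons')

text \<open>What the letters after \<open>w\<close> must provide to complete an increasing triple
  starting at \<open>w\<close>; this makes a recursion along the word possible.\<close>

definition increasing_pair_above :: "nat \<Rightarrow> nat list \<Rightarrow> bool" where
  "increasing_pair_above w \<pi> \<longleftrightarrow> (\<exists>x y. w < x \<and> x < y \<and> subseq [x, y] \<pi>)"

definition increasing_triple :: "nat list \<Rightarrow> bool" where
  "increasing_triple \<pi> \<longleftrightarrow> (\<exists>x y z. x < y \<and> y < z \<and> subseq [x, y, z] \<pi>)"

definition has_pivot :: "nat list \<Rightarrow> bool" where
  "has_pivot \<pi> \<longleftrightarrow> (\<exists>x y z. x < y \<and> y < z \<and> (subseq [y, x, z] \<pi> \<or> subseq [y, z, x] \<pi>))"

lemma increasing_triple_subseq: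
  "increasing_triple \<sigma> \<Longrightarrow> subseq \<sigma> \<pi> \<Longrightarrow> increasing_triple \<pi>"
  unfolding increasing_triple_def using subseq_order.order_trans by blast

lemma has_pivot_subseq: "has_pivot \<sigma> \<Longrightarrow> subseq \<sigma> \<pi> \<Longrightarrow> has_pivot \<pi>"
  unfolding has_pivot_def using subseq_order.order_trans by blast

lemma increasing_pair_above_Cons:
  "increasing_pair_above w (x # xs) \<longleftrightarrow>
     w < x \<and> (\<exists>y \<in> set xs. x < y) \<or> increasing_pair_above w xs"
  unfolding increasing_pair_above_def subseq_2_Cons by auto

lemma increasing_triple_Cons:
  "increasing_triple (x # xs) \<longleftrightarrow> increasing_pair_above x xs \<or> increasing_triple xs"
  unfolding increasing_triple_def increasing_pair_above_def subseq_3_Cons by auto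

lemma subseq_2_or_swap:
  "a \<noteq> b \<Longrightarrow> subseq [a, b] xs \<or> subseq [b, a] xs \<longleftrightarrow> a \<in> set xs \<and> b \<in> set xs"
  by (induction xs) (auto simp: subseq_2_Cons subseq_singleton_left)

text \<open>Since either order of the witnesses will do, only the set of letters after
  \<open>x\<close> matters, not their arrangement.\<close>

lemma has_pivot_Cons:
  "has_pivot (x # xs) \<longleftrightarrow>
     (\<exists>a \<in> set xs. a < x) \<and> (\<exists>c \<in> set xs. x < c) \<or> has_pivot xs"
proof -
  have "has_pivot (x # xs) \<longleftrightarrow>
      (\<exists>a c. a < x \<and> x < c \<and> (subseq [a, c] xs \<or> subseq [c, a] xs)) \<or> has_pivot xs"
    unfolding has_pivot_def subseq_3_Cons by blast
  then show ?thesis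
    using subseq_2_or_swap[of _ _ xs] by (metis less_trans nat_neq_iff)
qed

text \<open>Only \<open>x\<close> and \<open>z\<close> change their relative position. Where they
  form an increasing pair above \<open>w\<close>, it is replaced by \<open>y\<close>,
  \<open>z\<close> under the first rule and by \<open>x\<close>, \<open>y\<close> under the second.
  Letters of the prefix \<open>us\<close> keep the same set of followers.\<close>

lemma increasing_pair_above_step:
  assumes "knuth_step \<pi> \<sigma>" "distinct \<pi>"
  shows "increasing_pair_above w \<pi> \<longleftrightarrow> increasing_pair_above w \<sigma>"
  using assms
proof induction
  case (yzx x y z us vs)
  then show ?case
    by (induction us) (auto simp: increasing_pair_above_Cons)
next
  case (xzy x y z us vs)
  then show ?case
    by (induction us) (auto simp: increasing_pair_above_Cons)
qed

text \<open>A triple starting in \<open>us\<close> is covered by the invariance of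
  \<open>increasing_pair_above\<close>. A triple \<open>x\<close>, \<open>z\<close>,
  \<open>v\<close> with \<open>v\<close> in \<open>vs\<close> is replaced by \<open>y\<close>,
  \<open>z\<close>, \<open>v\<close> under the first rule and by \<open>x\<close>, \<open>y\<close>,
  \<open>v\<close> under the second.\<close>

lemma increasing_triple_step:
  assumes "knuth_step \<pi> \<sigma>" "distinct \<pi>"
  shows "increasing_triple \<pi> \<longleftrightarrow> increasing_triple \<sigma>"
  using assms
proof induction
  case (yzx x y z us vs)
  \<comment> \<open>Stated for every prefix, since the induction on \<open>us\<close> uses it at
    each tail.\<close>
  have "increasing_pair_above w (us @ y # z # x # vs) \<longleftrightarrow>
      increasing_pair_above w (us @ y # x # z # vs)"
    if "distinct (us @ y # z # x # vs)" for w us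
    using increasing_pair_above_step[OF knuth_step.yzx[of x y z us vs]] yzx that by simp
  with yzx show ?case
    by (induction us; auto simp: increasing_triple_Cons increasing_pair_above_Cons; fastforce)
next
  case (xzy x y z us vs)
  have "increasing_pair_above w (us @ x # z # y # vs) \<longleftrightarrow>
      increasing_pair_above w (us @ z # x # y # vs)"
    if "distinct (us @ x # z # y # vs)" for w us
    using increasing_pair_above_step[OF knuth_step.xzy[of x y z us vs]] xzy that by simp
  with xzy show ?case
    by (induction us; auto simp: increasing_triple_Cons increasing_pair_above_Cons; fastforce)
qed

text \<open>Only \<open>x\<close> and \<open>z\<close> change their set of followers. Under the
  first rule \<open>y\<close> is a pivot on both sides. Under the second, \<open>y\<close> follows
  both of them on both sides, and replaces \<open>z\<close> as a larger letter after
  \<open>x\<close> and \<open>x\<close> as a smaller letter after \<open>z\<close>.\<close>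

lemma has_pivot_step:
  assumes "knuth_step \<pi> \<sigma>" "distinct \<pi>"
  shows "has_pivot \<pi> \<longleftrightarrow> has_pivot \<sigma>"
  using assms
proof induction
  case (yzx x y z us vs)
  then show ?case
    by (induction us) (auto simp: has_pivot_Cons)
next
  case (xzy x y z us vs)
  then show ?case
    by (induction us) (auto simp: has_pivot_Cons)
qed

section \<open>Bringing a pivot next to its witnesses\<close>

lemma pivot_adjacent:
  assumes "distinct (us @ y # vs)" "x \<in> set vs" "z \<in> set vs" "x < y" "y < z"
  shows "\<exists>us' vs' a b c. a < b \<and> b < c \<and> knuth_equiv (us @ y # vs) (us' @ [b, a, c] @ vs')"
  using assms
\<comment> \<open>Moving the pivot to the right and passing to the next letter as pivot both leave
  one letter fewer after the pivot.\<close>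
proof (induction "length vs" arbitrary: us y vs x z rule: less_induct)
  case less
  let ?goal = "\<lambda>\<pi>. \<exists>us' vs' a b c. a < b \<and> b < c \<and> knuth_equiv \<pi> (us' @ [b, a, c] @ vs')"
  have goalI: "?goal \<pi>"
    if "a < b" "b < c" "knuth_equiv \<pi> (us' @ [b, a, c] @ vs')" for a b c \<pi> us' vs'
    using that by blast
  \<comment> \<open>The letters \<open>x\<close> and \<open>z\<close> of \<open>vs\<close> are
    different, so \<open>vs\<close> has at least two letters; \<open>remdups_adj.cases\<close>
    separates lists of length zero, one and at least two.\<close>
  from less.prems obtain d e ws where vs: "vs = d # e # ws"
    by (cases vs rule: remdups_adj.cases) auto
  have next_pivot: ?case if "x' \<in> set (e # ws)" "z' \<in> set (e # ws)" "x' < d" "d < z'" for x' z'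
    using less.hyps[of "e # ws" "us @ [y]" d x' z'] less.prems(1) that by (simp add: vs)
  have move_pivot: ?case
    if "knuth_equiv (us @ [y, d, e] @ ws) (us @ [d, y, e] @ ws)"
      "x' \<in> set (e # ws)" "z' \<in> set (e # ws)" "x' < y" "y < z'" for x' z'
  proof -
    have "?goal (us @ [d, y, e] @ ws)"
      using less.hyps[of "e # ws" "us @ [d]" y x' z'] less.prems(1) that by (auto simp: vs)
    then show ?thesis using that(1) knuth_equiv_trans unfolding vs by fastforce
  qed
  have "d \<noteq> y" "e \<noteq> y" "d \<noteq> e"
    using less.prems(1) by (auto simp: vs)
  \<comment> \<open>The cases depend on the median of \<open>y\<close>, \<open>d\<close>,
    \<open>e\<close>. If it is \<open>y\<close>, the goal is reached, in one case after a step; if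
    it is \<open>e\<close>, then \<open>e\<close> licenses swapping \<open>y\<close> and
    \<open>d\<close>; if it is \<open>d\<close>, then \<open>d\<close> becomes the pivot. In each
    recursive call \<open>e\<close> replaces the witness on the side of \<open>y\<close> where
    \<open>d\<close> lies, as that witness may be \<open>d\<close> itself; the other witness lies
    beyond \<open>y\<close> and hence differs from \<open>d\<close>.\<close>
  then consider "d < y" "y < e" | "e < y" "y < d" | "d < e" "e < y" | "e < d" "d < y"
    | "y < d" "d < e" | "y < e" "e < d"
    by (metis linorder_neqE_nat)
  then show ?case
  proof cases
    case 1
    then show ?thesis using goalI[of d y e "us @ y # vs" us ws] by (simp add: vs)
  next
    case 2
    then have "knuth_equiv (us @ [y, d, e] @ ws) (us @ [y, e, d] @ ws)"
      by (intro knuth_step_imp_equiv knuth_step.yzx) auto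
    with 2 show ?thesis using goalI[of e y d "us @ y # vs" us ws] by (simp add: vs)
  next
    case 3
    then have "knuth_equiv (us @ [y, d, e] @ ws) (us @ [d, y, e] @ ws)"
      by (intro knuth_equiv_sym[OF knuth_step_imp_equiv] knuth_step.xzy) auto
    with 3 less.prems show ?thesis by (intro move_pivot[of e z]) (auto simp: vs)
  next
    case 4
    with less.prems show ?thesis by (intro next_pivot[of e z]) (auto simp: vs)
  next
    case 5
    with less.prems show ?thesis by (intro next_pivot[of x e]) (auto simp: vs)
  next
    case 6
    then have "knuth_equiv (us @ [y, d, e] @ ws) (us @ [d, y, e] @ ws)"
      by (intro knuth_step_imp_equiv knuth_step.xzy) auto
    with 6 less.prems show ?thesis by (intro move_pivot[of x e]) (auto simp: vs)
  qed
qed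

lemma has_pivot_split:
  assumes "has_pivot \<pi>"
  obtains us y vs x z where "\<pi> = us @ y # vs" "x \<in> set vs" "z \<in> set vs" "x < y" "y < z"
proof -
  have "has_pivot \<pi> \<Longrightarrow>
      \<exists>us y vs. \<pi> = us @ y # vs \<and> (\<exists>x \<in> set vs. x < y) \<and> (\<exists>z \<in> set vs. y < z)"
  proof (induction \<pi>)
    case Nil
    then show ?case by (simp add: has_pivot_def)
  next
    case (Cons w \<pi>)
    then show ?case unfolding has_pivot_Cons by (metis append_Cons append_Nil)
  qed
  with assms that show ?thesis by blast
qed

lemma subseq_infix: "subseq ws (us @ ws @ vs)"
  by (simp add: subseq_drop_many subseq_rev_drop_many)

lemma has_pivot_reach:
  assumes "distinct \<pi>" "has_pivot \<pi>" "p = [2, 1, 3] \<or> p = [2, 3, 1]"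
  shows "\<exists>\<sigma>. knuth_equiv \<pi> \<sigma> \<and> \<not> avoids \<sigma> p"
proof -
  obtain us vs a b c where abc: "a < b" "b < c" "knuth_equiv \<pi> (us @ [b, a, c] @ vs)"
    using has_pivot_split[OF assms(2)] pivot_adjacent assms(1) by metis
  have "knuth_equiv (us @ [b, a, c] @ vs) (us @ [b, c, a] @ vs)"
    using abc by (intro knuth_equiv_sym[OF knuth_step_imp_equiv] knuth_step.yzx) auto
  with abc have "knuth_equiv \<pi> (us @ [b, c, a] @ vs)"
    using knuth_equiv_trans by blast
  moreover have "\<not> avoids (us @ [b, a, c] @ vs) [2, 1, 3]"
    using abc(1,2) subseq_infix[of "[b, a, c]" us vs] unfolding contains_213 by blast
  moreover have "\<not> avoids (us @ [b, c, a] @ vs) [2, 3, 1]"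
    using abc(1,2) subseq_infix[of "[b, c, a]" us vs] unfolding contains_231 by blast
  ultimately show ?thesis using abc(3) assms(3) by blast
qed

section \<open>Stability of the patterns of length 3\<close>

lemma has_pivot_3:
  "has_pivot [p, q, r] \<longleftrightarrow> q < p \<and> p < r \<or> r < p \<and> p < q"
proof -
  have "\<not> has_pivot []" by (simp add: has_pivot_def)
  then show ?thesis by (auto simp: has_pivot_Cons)
qed

lemma increasing_triple_3:
  "increasing_triple [p, q, r] \<longleftrightarrow> p < q \<and> q < r"
proof -
  have "\<not> increasing_pair_above w []" "\<not> increasing_triple []" for w
    by (simp_all add: increasing_pair_above_def increasing_triple_def)
  then show ?thesis by (auto simp: increasing_triple_Cons increasing_pair_above_Cons)
qed

lemma stable_123: "stable_pattern [1, 2, 3]"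
proof (rule stable_patternI[where Q = increasing_triple])
  show "increasing_triple \<pi>"
    if hyps: "length q = length [1, 2, 3 :: nat]" "increasing_triple q" "\<not> avoids \<pi> q" for \<pi> q
  proof -
    obtain a b c where q: "q = [a, b, c]" using hyps(1) by (auto simp: length_Suc_conv)
    obtain x y z where "subseq [x, y, z] \<pi>" "same_relative_order [x, y, z] [a, b, c]"
      using hyps(3) unfolding q contains_3 by blast
    moreover from this(2) have "increasing_triple [x, y, z]"
      using hyps(2) by (simp add: q increasing_triple_3 same_relative_order_3)
    ultimately show ?thesis by (blast intro: increasing_triple_subseq)
  qed
  \<comment> \<open>The invariant is containment of 123 itself, so the word already contains the
    pattern and reflexivity of \<open>knuth_equiv\<close> suffices below.\<close>
  have *: "\<not> avoids \<pi> [1, 2, 3]" if "increasing_triple \<pi>" for \<pi>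
    using that unfolding increasing_triple_def contains_123 .
  moreover have "[1, 2, 3] \<in> pattern_class [1, 2, 3]"
    by (auto simp: pattern_class_def permutations_of_set_def)
  ultimately show "\<exists>q \<in> pattern_class [1, 2, 3]. \<not> avoids \<pi> q" if "increasing_triple \<pi>" for \<pi>
    using that by blast
  show "\<exists>\<sigma>. knuth_equiv \<pi> \<sigma> \<and> \<not> avoids \<sigma> [1, 2, 3]" if "increasing_triple \<pi>" for \<pi>
    using * that knuth_equiv_refl by blast
  show "increasing_triple [1, 2, 3]" "distinct [1, 2, 3 :: nat]"
    by (simp_all add: increasing_triple_3)
qed (rule increasing_triple_step)

lemma stable_213_231:
  assumes "p = [2, 1, 3] \<or> p = [2, 3, 1]"
  shows "stable_pattern p"
proof (rule stable_patternI[where Q = has_pivot])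
  show "has_pivot \<pi>" if hyps: "length q = length p" "has_pivot q" "\<not> avoids \<pi> q" for \<pi> q
  proof -
    obtain a b c where q: "q = [a, b, c]" using hyps(1) assms by (auto simp: length_Suc_conv)
    obtain x y z where "subseq [x, y, z] \<pi>" "same_relative_order [x, y, z] [a, b, c]"
      using hyps(3) unfolding q contains_3 by blast
    moreover from this(2) have "has_pivot [x, y, z]"
      using hyps(2) by (simp add: q has_pivot_3 same_relative_order_3)
    ultimately show ?thesis by (blast intro: has_pivot_subseq)
  qed
  \<comment> \<open>A single step with empty context puts each of the two patterns into the class of
    the other.\<close>
  have "knuth_equiv [2, 3, 1] [2, 1, 3]"
    using knuth_step.yzx[of 1 2 3 "[]" "[]"] by (auto intro: knuth_step_imp_equiv)
  then have "[2, 1, 3] \<in> pattern_class p" "[2, 3, 1] \<in> pattern_class p"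
    using assms by (auto simp: pattern_class_def permutations_of_set_def intro: knuth_equiv_sym)
  moreover have "\<not> avoids \<pi> [2, 1, 3] \<or> \<not> avoids \<pi> [2, 3, 1]" if "has_pivot \<pi>" for \<pi>
    using that unfolding has_pivot_def contains_213 contains_231 by blast
  ultimately show "\<exists>q \<in> pattern_class p. \<not> avoids \<pi> q" if "has_pivot \<pi>" for \<pi>
    using that by blast
  show "has_pivot p" "distinct p"
    using assms by (auto simp: has_pivot_3)
  show "\<exists>\<sigma>. knuth_equiv \<pi> \<sigma> \<and> \<not> avoids \<sigma> p" if "distinct \<pi>" "has_pivot \<pi>" for \<pi>
    using has_pivot_reach[OF that assms] .
qed (rule has_pivot_step)

theorem corollary5p11:
  fixes p :: "nat list"
  assumes "p \<in> Sym 3"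
  shows "stable_pattern p"
proof -
  have "length p = 3"
    using length_finite_permutations_of_set[OF assms] by simp
  then obtain a b c where abc: "p = [a, b, c]"
    unfolding length_3_conv by blast
  have "{1..3} = {1, 2, 3 :: nat}"
    by auto
  then have p: "{a, b, c} = {1, 2, 3}" "distinct [a, b, c]"
    using assms abc by (simp_all add: permutations_of_set_def)
  then have "a \<in> {1, 2, 3}" "b \<in> {1, 2, 3}" "c \<in> {1, 2, 3}"
    by blast+
  \<comment> \<open>The three reversed words are 321, 312 and 132, so all six permutations are
    listed.\<close>
  with p(2) have "p \<in> {[1, 2, 3], [2, 1, 3], [2, 3, 1], rev [1, 2, 3], rev [2, 1, 3], rev [2, 3, 1]}"
    unfolding abc by (elim insertE emptyE) simp_all
  moreover have "stable_pattern q" "stable_pattern (rev q)"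
    if "q \<in> {[1, 2, 3], [2, 1, 3], [2, 3, 1]}" for q
  proof -
    show "stable_pattern q" using that stable_123 stable_213_231 by blast
    then show "stable_pattern (rev q)" by (rule stable_pattern_rev) (use that in auto)
  qed
  ultimately show ?thesis by blast
qed

end
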